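(* Let $k, m \geq 1$ be integers and let $t \in \mathbb{Z}_{2^k}$. Then $$ N^*_m(t, 2^k) = \begin{cases} 1 & \text{if } k = 1 \text{ and } t \equiv m \pmod 2, \\ 2^m & \text{if } k = 2 \text{ and } t \equiv m \pmod 4, \\ 2^{2m + (m-1)(k-3)} & \text{if } k \geq 3 \text{ and } t \equiv m \pmod 8, \\ 0 & \text{otherwise.} \end{cases} $$
   Context: $\mathbb{Z}_n$ denotes the ring of integers modulo $n$, and $\mathbb{Z}_n^*$ its set of units (the classes coprime to $n$). For $t \in \mathbb{Z}_n$, $N^*_m(t,n)$ is the number of ordered $m$-tuples $(x_1,\dots,x_m)$ with all $x_i \in \mathbb{Z}_n^*$ and $\sum_{i=1}^m x_i^2 \equiv t \pmod n$. *)

theory Defs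
  imports "HOL-Number_Theory.Number_Theory"
begin

text \<open>
  \<open>N_star m t n\<close> is \<open>N\<^sup>*\<^sub>m(t, n)\<close>. Tuples \<open>(x\<^sub>1, \<dots>, x\<^sub>m)\<close> are extensional functions on \<open>{1..m}\<close>.
  The definition is meant for \<open>n > 1\<close>: \<^const>\<open>residue_ring\<close> has unit element \<open>1\<close>, which lies outside
  the carrier when \<open>n = 1\<close>.
\<close>

definition N_star :: "nat \<Rightarrow> int \<Rightarrow> int \<Rightarrow> nat" where
  "N_star m t n =
     card {x \<in> {1..m} \<rightarrow>\<^sub>E Units (residue_ring n). [(\<Sum>i=1..m. (x i)\<^sup>2) = t] (mod n)}"

end

theory Submission
  imports Defs
begin

text \<open>
  An odd square is \<open>1\<close> modulo \<open>8\<close>, so a sum of \<open>m\<close> unit squares modulo \<open>2 ^ k\<close> is \<open>m\<close> modulo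
  \<open>gcd (2 ^ k) 8\<close>; this is where the condition on \<open>t\<close> comes from. For \<open>k \<le> 2\<close> it already decides
  the congruence, and when it holds every one of the \<open>(2 ^ (k - 1)) ^ m\<close> tuples of units is a
  solution.

  Let \<open>k \<ge> 3\<close> and \<open>t \<equiv> m\<close> modulo \<open>8\<close>. Choose \<open>m - 1\<close> of the coordinates freely among the
  \<open>2 ^ (k - 1)\<close> units. The last one, \<open>y\<close>, must satisfy \<open>y\<^sup>2 \<equiv> t - s\<close>, where \<open>s\<close> is the sum of the
  squares chosen; since \<open>s \<equiv> m - 1\<close>, the right-hand side is \<open>1\<close> modulo \<open>8\<close>. Such a residue has
  exactly four square roots modulo \<open>2 ^ k\<close> (\<open>card_square_roots_two_power\<close>): one exists by lifting
  from \<open>2 ^ j\<close> to \<open>2 ^ (j + 1)\<close>, and it determines the others up to sign and the addition of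
  \<open>2 ^ (k - 1)\<close>. So there are \<open>4 * 2 ^ ((k - 1) * (m - 1))\<close> solutions.
\<close>

section \<open>Odd squares and square roots modulo powers of two\<close>

lemma odd_square_cong_1_mod_8:
  fixes x :: int
  assumes "odd x"
  shows "[x\<^sup>2 = 1] (mod 8)"
proof -
  obtain a where a: "x = 2 * a + 1" using assms by (elim oddE)
  have "even (a * (a + 1))" by simp
  then obtain b where b: "a * (a + 1) = 2 * b" by (elim evenE)
  have "x\<^sup>2 - 1 = 4 * (a * (a + 1))" by (simp add: a power2_eq_square algebra_simps)
  then have "x\<^sup>2 - 1 = 8 * b" using b by simp
  then show ?thesis by (simp add: cong_iff_dvd_diff)
qed

lemma sum_odd_squares_cong_card:
  fixes x :: "'a \<Rightarrow> int"
  assumes "\<And>i. i \<in> I \<Longrightarrow> odd (x i)"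
  shows "[(\<Sum>i\<in>I. (x i)\<^sup>2) = int (card I)] (mod 8)"
proof -
  have "[(\<Sum>i\<in>I. (x i)\<^sup>2) = (\<Sum>i\<in>I. 1)] (mod 8)"
    by (intro cong_sum odd_square_cong_1_mod_8 assms)
  then show ?thesis by simp
qed

text \<open>
  Hensel lifting in the ramified case: if \<open>r\<^sup>2 - a = 2 ^ j * c\<close> with \<open>c\<close> odd, replacing \<open>r\<close> by
  \<open>r + 2 ^ (j - 1)\<close> adds \<open>2 ^ j * r\<close>, an odd multiple of \<open>2 ^ j\<close>, and \<open>2 ^ (2 * j - 2)\<close>, which
  vanishes modulo \<open>2 ^ (j + 1)\<close> because \<open>j \<ge> 3\<close>.
\<close>

lemma square_root_two_power_exists:
  fixes a :: int
  assumes "k \<ge> 3" and "[a = 1] (mod 8)"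
  shows "\<exists>r. odd r \<and> [r\<^sup>2 = a] (mod 2 ^ k)"
  using assms(1)
proof (induction k rule: nat_induct_at_least)
  case base
  have "odd (1::int) \<and> [1\<^sup>2 = a] (mod 2 ^ 3)" using assms(2) by (simp add: cong_sym)
  then show ?case by blast
next
  case (Suc j)
  then obtain r where r: "odd r" "[r\<^sup>2 = a] (mod 2 ^ j)" by blast
  obtain c where c: "r\<^sup>2 - a = 2 ^ j * c"
    using r(2) by (auto simp: cong_iff_dvd_diff)
  show ?case
  proof (cases "even c")
    case True
    then obtain d where "c = 2 * d" by (elim evenE)
    then have "r\<^sup>2 - a = 2 ^ Suc j * d" using c by simp
    then have "[r\<^sup>2 = a] (mod 2 ^ Suc j)" unfolding cong_iff_dvd_diff by simp
    then show ?thesis using r(1) by blast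
  next
    case False
    obtain i where i: "j = i + 3" using Suc(1) by (metis add.commute le_Suc_ex)
    define s where "s = r + 2 ^ (i + 2)"
    have "even (c + r)" using False r(1) by simp
    then obtain d where d: "c + r = 2 * d" by (elim evenE)
    have "s\<^sup>2 - a = (r\<^sup>2 - a) + 2 ^ j * r + 2 ^ Suc j * 2 ^ i"
      by (simp add: s_def i power2_eq_square power_add algebra_simps)
    also have "\<dots> = 2 ^ j * (c + r) + 2 ^ Suc j * 2 ^ i"
      by (simp add: c algebra_simps)
    also have "\<dots> = 2 ^ Suc j * (d + 2 ^ i)" by (simp add: d algebra_simps)
    finally have "[s\<^sup>2 = a] (mod 2 ^ Suc j)" by (simp only: cong_iff_dvd_diff dvd_triv_left)
    moreover have "odd s" using r(1) by (simp add: s_def)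
    ultimately show ?thesis by blast
  qed
qed

text \<open>
  In \<open>(x - r) * (x + r)\<close> both factors are even, but their sum \<open>2 * x\<close> is not divisible by \<open>4\<close>.
  So one factor is twice an odd number, and the other is divisible by \<open>2 ^ j\<close>.
\<close>

lemma square_cong_two_power_iff:
  fixes x r :: int
  assumes "odd x" "odd r" "j \<ge> 1"
  shows "[x\<^sup>2 = r\<^sup>2] (mod 2 ^ Suc j) \<longleftrightarrow> [x = r] (mod 2 ^ j) \<or> [x = - r] (mod 2 ^ j)"
proof -
  have "even (x - r)" using assms by simp
  then obtain u where u: "x - r = 2 * u" by (elim evenE)
  have v: "x + r = 2 * (u + r)" using u by simp
  have "x\<^sup>2 - r\<^sup>2 = (x - r) * (x + r)" by (simp add: power2_eq_square algebra_simps)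
  also have "\<dots> = 2 * (2 * (u * (u + r)))" unfolding u v by simp
  finally have sq: "x\<^sup>2 - r\<^sup>2 = 2 * (2 * (u * (u + r)))" .
  obtain i where i: "j = Suc i" using assms(3) by (cases j) auto
  have "(2 ^ i dvd u * (u + r)) \<longleftrightarrow> 2 ^ i dvd u \<or> 2 ^ i dvd u + r"
  proof (cases "even u")
    case True
    then have "coprime (2 ^ i) (u + r)" using assms(2) by simp
    then show ?thesis by (metis coprime_dvd_mult_left_iff dvd_mult)
  next
    case False
    then have "coprime (2 ^ i) u" by simp
    then show ?thesis by (metis coprime_dvd_mult_right_iff dvd_mult2)
  qed
  then show ?thesis by (simp add: cong_iff_dvd_diff sq i u v del: distrib_left_numeral)
qed

text \<open>
  The roots of \<open>r\<^sup>2\<close> are \<open>r\<close>, \<open>- r\<close>, \<open>r + 2 ^ (k - 1)\<close> and \<open>- r + 2 ^ (k - 1)\<close>: a class modulo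
  \<open>2 ^ (k - 1)\<close> splits into two modulo \<open>2 ^ k\<close>. The classes of \<open>r\<close> and \<open>- r\<close> modulo \<open>2 ^ (k - 1)\<close>
  are distinct as \<open>4\<close> divides \<open>2 ^ (k - 1)\<close> but not \<open>2 * r\<close>.
\<close>

lemma card_square_roots_two_power:
  fixes a :: int
  assumes "k \<ge> 3" and "[a = 1] (mod 8)"
  shows "card {x \<in> {0..<2 ^ k}. odd x \<and> [x\<^sup>2 = a] (mod 2 ^ k)} = 4"
proof -
  obtain r where r: "odd r" "[r\<^sup>2 = a] (mod 2 ^ k)"
    using square_root_two_power_exists[OF assms] by blast
  obtain i where i: "k = Suc (i + 2)" using assms(1) by (metis add_2_eq_Suc' add_Suc_right le_Suc_ex numeral_3_eq_3 add.commute)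
  define h :: int where "h = 2 ^ (i + 2)"
  have h4: "4 dvd h" "h > 0" by (simp_all add: h_def power_add)
  have k: "2 ^ k = 2 * h" by (simp add: h_def i)
  define u where "u = r mod h"
  define v where "v = (- r) mod h"
  have uv: "0 \<le> u" "u < h" "0 \<le> v" "v < h" using h4 by (simp_all add: u_def v_def)
  have "u \<noteq> v"
  proof
    assume "u = v"
    then have "h dvd r - (- r)" unfolding u_def v_def by (simp only: mod_eq_dvd_iff)
    then have "4 dvd 2 * r" using h4(1) dvd_trans by fastforce
    then show False using r(1) by presburger
  qed
  have evh: "even h" using h4(1) by presburger
  have odd_uv: "odd u" "odd v"
    using r(1) evh by (simp_all add: u_def v_def dvd_mod_iff)
  have lift: "x \<in> {0..<2 * h} \<and> x mod h = w \<longleftrightarrow> x = w \<or> x = w + h"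
    if w: "0 \<le> w" "w < h" for x w
  proof
    assume x: "x \<in> {0..<2 * h} \<and> x mod h = w"
    show "x = w \<or> x = w + h"
    proof (cases "x < h")
      case True then show ?thesis using x by auto
    next
      case False
      then have "x mod h = (x - h) mod h" by simp
      also have "\<dots> = x - h" using x False by (intro mod_pos_pos_trivial) auto
      finally show ?thesis using x by simp
    qed
  qed (use w in auto)
  have "x \<in> {0..<2 ^ k} \<and> odd x \<and> [x\<^sup>2 = a] (mod 2 ^ k) \<longleftrightarrow> x \<in> {u, u + h, v, v + h}" for x
  proof -
    have "[x\<^sup>2 = a] (mod 2 ^ k) \<longleftrightarrow> x mod h = u \<or> x mod h = v" if "odd x"
    proof -
      have "[x\<^sup>2 = a] (mod 2 ^ k) \<longleftrightarrow> [x\<^sup>2 = r\<^sup>2] (mod 2 ^ k)"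
        using r(2) cong_sym cong_trans by blast
      also have "\<dots> \<longleftrightarrow> [x = r] (mod h) \<or> [x = - r] (mod h)"
        unfolding i h_def using that r(1) by (intro square_cong_two_power_iff) auto
      finally show ?thesis by (simp add: cong_def u_def v_def)
    qed
    moreover have "odd x" if "x \<in> {u, u + h, v, v + h}"
      using that odd_uv evh by auto
    ultimately show ?thesis
      using lift[OF uv(1,2), of x] lift[OF uv(3,4), of x] by (auto simp only: k insert_iff empty_iff)
  qed
  then have "{x \<in> {0..<2 ^ k}. odd x \<and> [x\<^sup>2 = a] (mod 2 ^ k)} = {u, u + h, v, v + h}"
    by blast
  moreover have "card {u, u + h, v, v + h} = 4" using uv \<open>u \<noteq> v\<close> by auto
  ultimately show ?thesis by simp
qed

section \<open>Counting tuples of units\<close>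

lemma Units_residue_ring_two_power:
  assumes "k \<ge> 1"
  shows "Units (residue_ring (2 ^ k)) = {x \<in> {0..<2 ^ k}. odd x}"
proof -
  have "(1::int) < 2 ^ k" using assms by simp
  then interpret residues "2 ^ k" "residue_ring (2 ^ k)"
    by unfold_locales simp_all
  have "coprime x (2 ^ k) \<longleftrightarrow> odd x" for x :: int using assms by simp
  moreover have "x \<noteq> 0" if "odd x" for x :: int using that by auto
  ultimately show ?thesis by (fastforce simp: res_units_eq)
qed

lemma card_odd_below_two_power:
  assumes "k \<ge> 1"
  shows "card {x \<in> {0..<2 ^ k}. odd (x :: int)} = 2 ^ (k - 1)"
proof -
  obtain j where k: "k = Suc j" using assms by (cases k) auto
  have "bij_betw (\<lambda>y. 2 * y + 1) {0..<2 ^ j} {x \<in> {0..<2 ^ k}. odd (x :: int)}"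
    by (rule bij_betw_byWitness[where f' = "\<lambda>x. x div 2"]) (auto simp: k elim!: oddE)
  then have "card {x \<in> {0..<2 ^ k}. odd (x :: int)} = card {0..<(2::int) ^ j}"
    by (rule bij_betw_same_card[symmetric])
  also have "\<dots> = 2 ^ (k - 1)" by (simp add: k nat_power_eq)
  finally show ?thesis .
qed

text \<open>
  Fibring over the other coordinates reduces counting the solutions of an additive congruence in
  several variables to counting those of a congruence in the one variable \<open>x j\<close>.
\<close>

lemma card_PiE_insert_sum_cong:
  fixes f :: "'b \<Rightarrow> int"
  assumes "finite I" "j \<notin> I" "finite U"
  shows "card {x \<in> insert j I \<rightarrow>\<^sub>E U. [(\<Sum>i\<in>insert j I. f (x i)) = t] (mod n)} =
    (\<Sum>g\<in>I \<rightarrow>\<^sub>E U. card {y \<in> U. [f y = t - (\<Sum>i\<in>I. f (g i))] (mod n)})"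
proof -
  let ?S = "SIGMA g:I \<rightarrow>\<^sub>E U. {y \<in> U. [f y = t - (\<Sum>i\<in>I. f (g i))] (mod n)}"
  let ?h = "\<lambda>(g, y). g(j := y)"
  have sum_upd: "(\<Sum>i\<in>insert j I. f ((g(j := y)) i)) = f y + (\<Sum>i\<in>I. f (g i))" for g y
  proof -
    have "(\<Sum>i\<in>I. f ((g(j := y)) i)) = (\<Sum>i\<in>I. f (g i))"
      using assms(2) by (intro sum.cong) auto
    then show ?thesis using assms(1,2) by simp
  qed
  have "inj_on ?h ((I \<rightarrow>\<^sub>E U) \<times> U)"
    using inj_combinator[OF assms(2), of "\<lambda>_. U"] by (fastforce simp: inj_on_def)
  then have inj: "inj_on ?h ?S" by (rule inj_on_subset) auto
  have cong_upd: "[(\<Sum>i\<in>insert j I. f ((g(j := y)) i)) = t] (mod n) \<longleftrightarrow>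
      [f y = t - (\<Sum>i\<in>I. f (g i))] (mod n)" for g y
    unfolding sum_upd cong_iff_dvd_diff by (simp add: algebra_simps)
  have img: "{x \<in> insert j I \<rightarrow>\<^sub>E U. [(\<Sum>i\<in>insert j I. f (x i)) = t] (mod n)} = ?h ` ?S"
    unfolding PiE_insert_eq using cong_upd by (auto simp del: fun_upd_apply)
  have "card (?h ` ?S) = card ?S" by (rule card_image[OF inj])
  also have "\<dots> = (\<Sum>g\<in>I \<rightarrow>\<^sub>E U. card {y \<in> U. [f y = t - (\<Sum>i\<in>I. f (g i))] (mod n)})"
    using assms by (intro card_SigmaI finite_PiE) auto
  finally show ?thesis unfolding img .
qed

theorem theorem1p1:
  fixes k m :: nat and t :: int
  assumes "k \<ge> 1" and "m \<ge> 1"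
    and "t \<in> carrier (residue_ring (2 ^ k))"
  shows "N_star m t (2 ^ k) =
    (if k = 1 \<and> [t = int m] (mod 2) then 1
     else if k = 2 \<and> [t = int m] (mod 4) then 2 ^ m
     else if k \<ge> 3 \<and> [t = int m] (mod 8) then 2 ^ (2 * m + (m - 1) * (k - 3))
     else 0)"
proof -
  define U where "U = {x \<in> {0..<2 ^ k}. odd (x :: int)}"
  define X where "X = {1..m} \<rightarrow>\<^sub>E U"
  have N: "N_star m t (2 ^ k) = card {x \<in> X. [(\<Sum>i=1..m. (x i)\<^sup>2) = t] (mod 2 ^ k)}"
    unfolding N_star_def X_def U_def Units_residue_ring_two_power[OF assms(1)] ..
  have finU: "finite U" unfolding U_def by (rule finite_subset[of _ "{0..<2 ^ k}"]) auto
  have cardU: "card U = 2 ^ (k - 1)"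
    unfolding U_def by (rule card_odd_below_two_power[OF assms(1)])
  have sum_mod_8: "[(\<Sum>i=1..n. (x i)\<^sup>2) = int n] (mod 8)" if "x \<in> {1..n} \<rightarrow>\<^sub>E U" for x n
  proof -
    have "odd (x i)" if "i \<in> {1..n}" for i
      using PiE_mem[OF \<open>x \<in> {1..n} \<rightarrow>\<^sub>E U\<close> that] by (simp add: U_def)
    then show ?thesis using sum_odd_squares_cong_card[of "{1..n}" x] by simp
  qed
  then have s: "[(\<Sum>i=1..m. (x i)\<^sup>2) = int m] (mod 8)" if "x \<in> X" for x
    using that by (simp add: X_def)
  show ?thesis
  proof (cases "k \<ge> 3")
    case False
    have dvd8: "(2::int) ^ k dvd 8"
      using False le_imp_power_dvd[of k 3 "2::int"] by simp
    have "[(\<Sum>i=1..m. (x i)\<^sup>2) = t] (mod 2 ^ k) \<longleftrightarrow> [t = int m] (mod 2 ^ k)" if "x \<in> X" for x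
      using cong_dvd_modulus[OF s[OF that] dvd8] cong_sym cong_trans by blast
    then have "{x \<in> X. [(\<Sum>i=1..m. (x i)\<^sup>2) = t] (mod 2 ^ k)} =
        (if [t = int m] (mod 2 ^ k) then X else {})" by auto
    moreover have "card X = (2 ^ (k - 1)) ^ m"
      by (simp add: X_def card_PiE cardU)
    moreover have "k = 1 \<or> k = 2" using assms(1) False by linarith
    ultimately show ?thesis unfolding N by auto
  next
    case k3: True
    then have dvd8: "(8::int) dvd 2 ^ k"
      using le_imp_power_dvd[of 3 k "2::int"] by simp
    show ?thesis
    proof (cases "[t = int m] (mod 8)")
      case False
      have "\<not> [(\<Sum>i=1..m. (x i)\<^sup>2) = t] (mod 2 ^ k)" if "x \<in> X" for x
        using s[OF that] False cong_dvd_modulus[OF _ dvd8] cong_sym cong_trans by blast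
      then have "{x \<in> X. [(\<Sum>i=1..m. (x i)\<^sup>2) = t] (mod 2 ^ k)} = {}" by blast
      then have "N_star m t (2 ^ k) = 0" unfolding N by (simp only: card.empty)
      then show ?thesis using False k3 by simp
    next
      case t: True
      obtain l where m: "m = Suc l" using assms(2) by (cases m) auto
      have ins: "{1..m} = insert m {1..l}" by (auto simp: m)
      have roots: "card {y \<in> U. [y\<^sup>2 = t - (\<Sum>i=1..l. (g i)\<^sup>2)] (mod 2 ^ k)} = 4"
        if "g \<in> {1..l} \<rightarrow>\<^sub>E U" for g
      proof -
        have "[t - (\<Sum>i=1..l. (g i)\<^sup>2) = 1] (mod 8)"
          using cong_diff[OF t sum_mod_8[OF that]] by (simp add: m)
        from card_square_roots_two_power[OF k3 this] show ?thesis
          by (simp add: U_def conj_assoc)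
      qed
      have "N_star m t (2 ^ k) = (\<Sum>g\<in>{1..l} \<rightarrow>\<^sub>E U.
          card {y \<in> U. [y\<^sup>2 = t - (\<Sum>i=1..l. (g i)\<^sup>2)] (mod 2 ^ k)})"
        unfolding N X_def ins by (rule card_PiE_insert_sum_cong) (auto simp: m finU)
      also have "\<dots> = (\<Sum>g\<in>{1..l} \<rightarrow>\<^sub>E U. 4)" using roots by (intro sum.cong) auto
      also have "\<dots> = 4 * (2 ^ (k - 1)) ^ l" by (simp add: card_PiE cardU)
      also have "\<dots> = 2 ^ (2 + (k - 1) * l)" by (simp add: power_add power_mult)
      also have "2 + (k - 1) * l = 2 * m + (m - 1) * (k - 3)"
      proof -
        obtain j where "k = j + 3" using k3 by (metis add.commute le_Suc_ex)
        then show ?thesis by (simp add: m algebra_simps)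
      qed
      finally show ?thesis using k3 t by simp
    qed
  qed
qed

end
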